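(* For every co-bipartite graph $G$, $\chi_s(G)=\chi_{rs}(G)=\chi_o(G)$.
   Context: All graphs are finite, simple and undirected. A graph is co-bipartite if its vertex set can be partitioned into two cliques. For $k\in\mathbb{N}$, a $k$-colouring of $G$ is a map $f:V(G)\to\{0,\dots,k-1\}$ with $f(x)\neq f(y)$ for every edge $xy$. A $k$-star colouring is a $k$-colouring such that no path on four vertices (not necessarily induced) uses only two colours. A $k$-restricted star colouring is a $k$-colouring with no path $x,y,z$ in $G$ (not necessarily induced) such that $f(y)>f(x)=f(z)$. A $k$-ordered colouring is a $k$-colouring such that every path in $G$ with at least two vertices whose two endpoints receive the same colour $i$ contains a vertex of colour $j>i$. $\chi_s(G)$, $\chi_{rs}(G)$, $\chi_o(G)$ are the least $k$ for which $G$ admits a $k$-star colouring, a $k$-restricted star colouring, and a $k$-ordered colouring, respectively. *)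

theory Defs
  imports Graph_Theory.Vertex_Walk
begin

text \<open>
  A finite simple undirected graph is an instance of the locale \<^locale>\<open>graph\<close>, in which an
  undirected edge is a symmetric pair of arcs. Paths are non-empty lists of distinct vertices, consecutive
  ones being adjacent (\<^const>\<open>vpath\<close>).
\<close>

definition clique_in :: "('a, 'b) pre_digraph \<Rightarrow> 'a set \<Rightarrow> bool" where
  "clique_in G S \<longleftrightarrow> S \<subseteq> verts G \<and> (\<forall>u\<in>S. \<forall>v\<in>S. u \<noteq> v \<longrightarrow> u \<rightarrow>\<^bsub>G\<^esub> v)"

text \<open>The two parts may be empty, so that complete graphs are co-bipartite.\<close>

definition co_bipartite :: "('a, 'b) pre_digraph \<Rightarrow> bool" where
  "co_bipartite G \<longleftrightarrow>
     (\<exists>A B. A \<union> B = verts G \<and> A \<inter> B = {} \<and> clique_in G A \<and> clique_in G B)"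

text \<open>Only the values of a colouring on the vertices of the graph matter.\<close>

definition colouring :: "('a, 'b) pre_digraph \<Rightarrow> nat \<Rightarrow> ('a \<Rightarrow> nat) \<Rightarrow> bool" where
  "colouring G k f \<longleftrightarrow>
     (\<forall>v\<in>verts G. f v < k) \<and> (\<forall>x y. x \<rightarrow>\<^bsub>G\<^esub> y \<longrightarrow> f x \<noteq> f y)"

definition star_colouring :: "('a, 'b) pre_digraph \<Rightarrow> nat \<Rightarrow> ('a \<Rightarrow> nat) \<Rightarrow> bool" where
  "star_colouring G k f \<longleftrightarrow>
     colouring G k f \<and> \<not> (\<exists>p. vpath p G \<and> length p = 4 \<and> card (f ` set p) \<le> 2)"

definition restricted_star_colouring :: "('a, 'b) pre_digraph \<Rightarrow> nat \<Rightarrow> ('a \<Rightarrow> nat) \<Rightarrow> bool" where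
  "restricted_star_colouring G k f \<longleftrightarrow>
     colouring G k f \<and> \<not> (\<exists>x y z. vpath [x, y, z] G \<and> f y > f x \<and> f x = f z)"

definition ordered_colouring :: "('a, 'b) pre_digraph \<Rightarrow> nat \<Rightarrow> ('a \<Rightarrow> nat) \<Rightarrow> bool" where
  "ordered_colouring G k f \<longleftrightarrow>
     colouring G k f \<and>
     (\<forall>p. vpath p G \<and> 2 \<le> length p \<and> f (hd p) = f (last p) \<longrightarrow> (\<exists>v\<in>set p. f v > f (hd p)))"

definition star_chromatic_number :: "('a, 'b) pre_digraph \<Rightarrow> nat" where
  "star_chromatic_number G = (LEAST k. \<exists>f. star_colouring G k f)"

definition restricted_star_chromatic_number :: "('a, 'b) pre_digraph \<Rightarrow> nat" where
  "restricted_star_chromatic_number G = (LEAST k. \<exists>f. restricted_star_colouring G k f)"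

definition ordered_chromatic_number :: "('a, 'b) pre_digraph \<Rightarrow> nat" where
  "ordered_chromatic_number G = (LEAST k. \<exists>f. ordered_colouring G k f)"

text \<open>
  An injective colouring has all three properties, so the minima above are over non-empty sets.
\<close>

lemma (in graph) colourings_exist:
  "\<exists>f. star_colouring G (card (verts G)) f \<and> restricted_star_colouring G (card (verts G)) f \<and>
       ordered_colouring G (card (verts G)) f"
proof -
  obtain f where f: "bij_betw f (verts G) {0..<card (verts G)}"
    using ex_bij_betw_finite_nat[OF finite_verts] by blast
  have inj: "inj_on f (verts G)" using f by (rule bij_betw_imp_inj_on)
  have lt: "f v < card (verts G)" if "v \<in> verts G" for v
    using bij_betwE[OF f] that by auto
  have col: "colouring G (card (verts G)) f"
    unfolding colouring_def
  proof (intro conjI ballI allI impI notI)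
    fix x y assume xy: "x \<rightarrow>\<^bsub>G\<^esub> y" and eq: "f x = f y"
    have "x \<in> verts G" "y \<in> verts G" using xy by (auto dest: adj_in_verts)
    then have "x = y" using eq inj by (simp add: inj_on_eq_iff)
    then show False using adj_not_same xy by blast
  qed (rule lt)
  have star: "card (f ` set p) = length p" if "vpath p G" for p
  proof -
    have "set p \<subseteq> verts G" "distinct p" using that by (auto simp: vpath_def vwalk_def)
    then show ?thesis
      using card_image[OF inj_on_subset[OF inj \<open>set p \<subseteq> verts G\<close>]] by (simp add: distinct_card)
  qed
  have ends: "f (hd p) \<noteq> f (last p)" if "vpath p G" "2 \<le> length p" for p
  proof
    assume eq: "f (hd p) = f (last p)"
    have p: "set p \<subseteq> verts G" "distinct p" "p \<noteq> []"
      using that by (auto simp: vpath_def vwalk_def)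
    then have "hd p = last p" using eq inj_onD[OF inj eq] hd_in_set last_in_set by blast
    then show False using p that(2) by (cases p) (auto split: if_splits)
  qed
  have "star_colouring G (card (verts G)) f"
    unfolding star_colouring_def using col star by simp
  moreover have "restricted_star_colouring G (card (verts G)) f"
    unfolding restricted_star_colouring_def using col ends[of "[x, y, z]" for x y z] by simp
  moreover have "ordered_colouring G (card (verts G)) f"
    unfolding ordered_colouring_def using col ends by blast
  ultimately show ?thesis by blast
qed

end

theory Submission
  imports Defs
begin

text \<open>
  In a co-bipartite graph every colour class has at most two vertices, at most one in each clique.
  If an edge joined the two cliques between vertices whose colours are both used twice, then it would
  extend, by the twins of its ends, to a two-coloured path on four vertices. So in a star colouring a
  path between two vertices of the same colour passes through a vertex whose colour is used once, and
  permuting the colours so that those used once become the largest makes the colouring ordered.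
\<close>

lemma colouring_less: "colouring G k f \<Longrightarrow> v \<in> verts G \<Longrightarrow> f v < k"
  by (simp add: colouring_def)

lemma colouring_adj: "colouring G k f \<Longrightarrow> x \<rightarrow>\<^bsub>G\<^esub> y \<Longrightarrow> f x \<noteq> f y"
  by (simp add: colouring_def)

lemma clique_in_adj:
  "clique_in G S \<Longrightarrow> u \<in> S \<Longrightarrow> v \<in> S \<Longrightarrow> u \<noteq> v \<Longrightarrow> u \<rightarrow>\<^bsub>G\<^esub> v"
  by (simp add: clique_in_def)

text \<open>Closure of \<open>A\<close> is asked only between vertices of the walk, because in its
  application the closure argument needs the colours of both ends, which are controlled only along
  the walk.\<close>

lemma vwalk_adj_closed:
  assumes "vwalk p G" and "hd p \<in> A"
    and "\<And>x y. x \<in> A \<Longrightarrow> x \<in> set p \<Longrightarrow> y \<in> set p \<Longrightarrow> x \<rightarrow>\<^bsub>G\<^esub> y \<Longrightarrow> y \<in> A"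
  shows "set p \<subseteq> A"
  using assms
proof (induction p rule: induct_list012)
  case (2 x)
  show ?case using "2.prems"(2) by simp
next
  case (3 x y zs)
  have "x \<in> A" "x \<rightarrow>\<^bsub>G\<^esub> y" using "3.prems"(1,2) by (simp_all add: vwalk_def)
  then have "y \<in> A" by (intro "3.prems"(3)[of x y]) simp_all
  have "set (y # zs) \<subseteq> A"
  proof (rule "3.IH"(2))
    show "vwalk (y # zs) G" using "3.prems"(1) by (simp add: vwalk_def)
    show "hd (y # zs) \<in> A" using \<open>y \<in> A\<close> by simp
    show "v \<in> A" if "u \<in> A" "u \<in> set (y # zs)" "v \<in> set (y # zs)" "u \<rightarrow>\<^bsub>G\<^esub> v" for u v
      using that by (intro "3.prems"(3)[of u v]) simp_all
  qed
  then show ?case using \<open>x \<in> A\<close> by simp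
qed simp

text \<open>Supplies the permutation of colours for the recolouring: \<open>D\<close> is sent onto
  the initial segment of length \<open>card D\<close> and the other colours onto the rest of
  \<open>{..<k}\<close>.\<close>

lemma ex_bij_betw_less_sorting:
  fixes k :: nat
  assumes "D \<subseteq> {..<k}"
  shows "\<exists>\<pi>. bij_betw \<pi> {..<k} {..<k} \<and> (\<forall>c\<in>D. \<forall>e\<in>{..<k} - D. \<pi> c < \<pi> e)"
proof -
  have fin: "finite D" using assms finite_subset by blast
  have le: "card D \<le> k" using card_mono[OF _ assms] by simp
  obtain g where g: "bij_betw g D {..<card D}"
    using fin by (metis card_lessThan finite_lessThan finite_same_card_bij)
  have "card ({..<k} - D) = card {card D..<k}"
    using assms fin by (simp add: card_Diff_subset)
  then obtain h where h: "bij_betw h ({..<k} - D) {card D..<k}"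
    using finite_same_card_bij[of "{..<k} - D" "{card D..<k}"] by auto
  define \<pi> where "\<pi> c = (if c \<in> D then g c else h c)" for c
  have "bij_betw \<pi> D {..<card D}"
    using g by (subst bij_betw_cong[where g = g]) (simp_all add: \<pi>_def)
  moreover have "bij_betw \<pi> ({..<k} - D) {card D..<k}"
    using h by (subst bij_betw_cong[where g = h]) (simp_all add: \<pi>_def)
  ultimately have "bij_betw \<pi> (D \<union> ({..<k} - D)) ({..<card D} \<union> {card D..<k})"
    by (rule bij_betw_combine) auto
  also have "D \<union> ({..<k} - D) = {..<k}"
    using assms by auto
  also have "{..<card D} \<union> {card D..<k} = {..<k}"
    using le by auto
  finally have "bij_betw \<pi> {..<k} {..<k}" .
  moreover have "\<pi> c < \<pi> e" if "c \<in> D" "e \<in> {..<k} - D" for c e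
  proof -
    have "g c < card D" "card D \<le> h e" using that bij_betwE[OF g] bij_betwE[OF h] by auto
    then show ?thesis using that by (simp add: \<pi>_def)
  qed
  ultimately show ?thesis by (intro exI[of _ \<pi>] conjI ballI)
qed

context graph
begin

text \<open>On a path \<open>x\<close>, \<open>y\<close>, \<open>z\<close> with ends of equal
  colour, an ordered colouring forces the middle colour to be the larger one, whereas a restricted
  star colouring forbids this; hence the order of the colours is reversed. The truncated subtraction
  is injective here since colours of vertices are below \<open>k\<close>.\<close>

lemma restricted_star_colouring_of_ordered:
  assumes f: "ordered_colouring G k f"
  shows "restricted_star_colouring G k (\<lambda>v. k - 1 - f v)"
proof -
  have col: "colouring G k f" using f by (simp add: ordered_colouring_def)
  have less: "f v < k" if "v \<in> verts G" for v using colouring_less[OF col that] .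
  have "colouring G k (\<lambda>v. k - 1 - f v)"
    unfolding colouring_def
  proof (intro conjI ballI allI impI)
    fix v assume "v \<in> verts G"
    then show "k - 1 - f v < k" using less[of v] by simp
  next
    fix x y assume xy: "x \<rightarrow>\<^bsub>G\<^esub> y"
    then have "f x < k" "f y < k" using less by (auto dest: adj_in_verts)
    then show "k - 1 - f x \<noteq> k - 1 - f y" using colouring_adj[OF col xy] by simp
  qed
  moreover have False
    if p: "vpath [x, y, z] G" and lt: "k - 1 - f y > k - 1 - f x"
      and eq: "k - 1 - f x = k - 1 - f z" for x y z
  proof -
    have "x \<in> verts G" "z \<in> verts G" using p by (auto simp: vpath_def vwalk_def)
    then have "f x = f z" using eq less[of x] less[of z] by simp
    then have "\<exists>v\<in>set [x, y, z]. f v > f (hd [x, y, z])"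
      using f p unfolding ordered_colouring_def by (elim conjE allE[of _ "[x, y, z]"]) simp
    then show False using lt \<open>f x = f z\<close> by auto
  qed
  ultimately show ?thesis by (auto simp: restricted_star_colouring_def)
qed

text \<open>Along a two-coloured path \<open>w\<close>, \<open>x\<close>, \<open>y\<close>,
  \<open>z\<close> the colours alternate. Its two subpaths on three vertices then require
  \<open>f x < f w\<close> and \<open>f y < f x\<close>, which is absurd as
  \<open>f w = f y\<close>.\<close>

lemma star_colouring_of_restricted:
  assumes f: "restricted_star_colouring G k f"
  shows "star_colouring G k f"
proof -
  have col: "colouring G k f" using f by (simp add: restricted_star_colouring_def)
  have no: "f y < f x" if "vpath [x, y, z] G" "f x = f z" for x y z
  proof -
    have "f x \<noteq> f y" using that(1) colouring_adj[OF col] by (simp add: vpath_def vwalk_def)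
    then show ?thesis using f that unfolding restricted_star_colouring_def by (metis linorder_neqE_nat)
  qed
  have False if p: "vpath p G" and "length p = 4" and card: "card (f ` set p) \<le> 2" for p
  proof -
    obtain w x y z where p_eq: "p = [w, x, y, z]"
      using \<open>length p = 4\<close> by (auto simp: numeral_eq_Suc length_Suc_conv)
    have "f w \<noteq> f x" "f x \<noteq> f y" "f y \<noteq> f z"
      using p colouring_adj[OF col] by (auto simp: p_eq vpath_def vwalk_def)
    then have "f w = f y" "f x = f z"
      using card by (auto simp: p_eq card_insert_if split: if_splits)
    moreover have "vpath [w, x, y] G" "vpath [x, y, z] G"
      using p by (auto simp: p_eq vpath_def vwalk_def)
    ultimately show False using no[of w x y] no[of x y z] by simp
  qed
  then show ?thesis using col by (auto simp: star_colouring_def)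
qed

lemma star_colouring_no_twinned_cross_edge:
  assumes f: "star_colouring G k f"
    and A: "clique_in G A" and B: "clique_in G B" and dis: "A \<inter> B = {}"
    and x: "x \<in> A" "x' \<in> B" "f x = f x'"
    and y: "y \<in> B" "y' \<in> A" "f y = f y'"
  shows "\<not> x \<rightarrow>\<^bsub>G\<^esub> y"
proof
  assume xy: "x \<rightarrow>\<^bsub>G\<^esub> y"
  have "colouring G k f" using f by (simp add: star_colouring_def)
  then have ne: "f x \<noteq> f y" using xy by (rule colouring_adj)
  \<comment> \<open>Either equality would give \<open>x\<close> and \<open>y\<close> the same
    colour. So each twin is adjacent to the end of the edge in its own clique.\<close>
  then have "y' \<noteq> x" "y \<noteq> x'" using x y by auto
  then have "y' \<rightarrow>\<^bsub>G\<^esub> x" "y \<rightarrow>\<^bsub>G\<^esub> x'"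
    using x y clique_in_adj[OF A] clique_in_adj[OF B] by auto
  moreover have "distinct [y', x, y, x']"
    using x y dis \<open>y' \<noteq> x\<close> \<open>y \<noteq> x'\<close> by auto
  ultimately have "vpath [y', x, y, x'] G"
    using xy by (auto simp: vpath_def vwalk_def dest: adj_in_verts)
  moreover have "card (f ` set [y', x, y, x']) \<le> 2"
    using x y by (simp add: card_insert_if)
  moreover have "length [y', x, y, x'] = 4" by simp
  ultimately show False using f unfolding star_colouring_def by blast
qed

lemma ordered_colouring_of_star:
  assumes "co_bipartite G" and f: "star_colouring G k f"
  shows "\<exists>g. ordered_colouring G k g"
proof -
  obtain A B where AB: "A \<union> B = verts G" "A \<inter> B = {}" "clique_in G A" "clique_in G B"
    using assms(1) by (auto simp: co_bipartite_def)
  have col: "colouring G k f" using f by (simp add: star_colouring_def)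
  note less = colouring_less[OF col]
  \<comment> \<open>The colours used at least twice; these become the small ones.\<close>
  define D where "D = {c. \<exists>u\<in>verts G. \<exists>v\<in>verts G. u \<noteq> v \<and> f u = c \<and> f v = c}"
  have "D \<subseteq> {..<k}" using less by (auto simp: D_def)
  then obtain \<pi> where \<pi>: "bij_betw \<pi> {..<k} {..<k}"
      and sep: "\<And>c e. c \<in> D \<Longrightarrow> e \<in> {..<k} - D \<Longrightarrow> \<pi> c < \<pi> e"
    using ex_bij_betw_less_sorting by metis
  have \<pi>_eq: "f u = f v" if "\<pi> (f u) = \<pi> (f v)" "u \<in> verts G" "v \<in> verts G" for u v
    using that less bij_betw_imp_inj_on[OF \<pi>] by (auto dest: inj_onD)
  have colg: "colouring G k (\<pi> \<circ> f)"
    unfolding colouring_def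
  proof (intro conjI ballI allI impI notI)
    fix v assume "v \<in> verts G"
    then show "(\<pi> \<circ> f) v < k" using less bij_betwE[OF \<pi>] by simp
  next
    fix x y assume xy: "x \<rightarrow>\<^bsub>G\<^esub> y" "(\<pi> \<circ> f) x = (\<pi> \<circ> f) y"
    then show False using \<pi>_eq[of x y] colouring_adj[OF col] by (auto dest: adj_in_verts)
  qed
  \<comment> \<open>The second vertex of the colour cannot lie in the clique \<open>S\<close>, where
    it would be adjacent to \<open>u\<close>.\<close>
  have twin: "\<exists>u'\<in>T. f u' = f u"
    if u: "u \<in> S" "f u \<in> D" and S: "clique_in G S" "S \<union> T = verts G" for S T u
  proof -
    obtain v w where "v \<in> verts G" "w \<in> verts G" "v \<noteq> w" "f v = f u" "f w = f u"
      using u(2) by (auto simp: D_def)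
    then obtain u' where u': "u' \<in> verts G" "u' \<noteq> u" "f u' = f u" by metis
    then have "u' \<notin> S"
      using u(1) clique_in_adj[OF S(1), of u u'] colouring_adj[OF col, of u u'] by auto
    then show ?thesis using u' S(2) by auto
  qed
  \<comment> \<open>Leaving \<open>S\<close> would use an edge to \<open>T\<close> whose ends both
    have twins on the opposite side. The cliques are kept as variables because a path may start in
    either of them.\<close>
  have inside: "set p \<subseteq> S"
    if p: "vwalk p G" "hd p \<in> S" and D: "f ` set p \<subseteq> D"
      and ST: "S \<union> T = verts G" "S \<inter> T = {}" "clique_in G S" "clique_in G T" for p S T
  proof (rule vwalk_adj_closed[OF p])
    fix x y assume xy: "x \<in> S" "x \<in> set p" "y \<in> set p" "x \<rightarrow>\<^bsub>G\<^esub> y"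
    show "y \<in> S"
    proof (rule ccontr)
      assume "y \<notin> S"
      then have "y \<in> T" using xy ST(1) by (auto dest: adj_in_verts)
      obtain x' where "x' \<in> T" "f x' = f x"
        using twin[of x S T] xy D ST by auto
      moreover obtain y' where "y' \<in> S" "f y' = f y"
        using twin[of y T S] \<open>y \<in> T\<close> xy D ST by auto
      ultimately show False
        using star_colouring_no_twinned_cross_edge[OF f ST(3,4,2), of x x' y y'] xy \<open>y \<in> T\<close> by simp
    qed
  qed
  have "\<exists>v\<in>set p. \<pi> (f v) > \<pi> (f (hd p))"
    if p: "vpath p G" "2 \<le> length p" and eq: "\<pi> (f (hd p)) = \<pi> (f (last p))" for p
  proof (rule ccontr)
    assume no: "\<not> (\<exists>v\<in>set p. \<pi> (f v) > \<pi> (f (hd p)))"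
    have walk: "vwalk p G" and V: "set p \<subseteq> verts G" and "distinct p" and "p \<noteq> []"
      using p by (auto simp: vpath_def vwalk_def)
    then have ends: "hd p \<in> set p" "last p \<in> set p" by auto
    have ne: "hd p \<noteq> last p" using \<open>distinct p\<close> p(2) by (cases p) auto
    have fe: "f (hd p) = f (last p)" using \<pi>_eq[OF eq] ends V by auto
    then have "f (hd p) \<in> D" using ne ends V by (auto simp: D_def)
    \<comment> \<open>The colour of the ends is in \<open>D\<close>, and \<open>\<pi>\<close> puts
      every colour outside \<open>D\<close> above it; a vertex with such a colour would contradict
      \<open>no\<close>.\<close>
    then have sub: "f ` set p \<subseteq> D" using sep no less V by fastforce
    \<comment> \<open>Confined to one clique, the path has distinct, hence adjacent, ends, which
      cannot share a colour.\<close>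
    obtain S where "hd p \<in> S" "last p \<in> S" "clique_in G S"
      using inside[OF walk _ sub, of A B] inside[OF walk _ sub, of B A] AB ends V
      by (metis Int_commute Un_commute Un_iff subsetD)
    then show False using clique_in_adj ne fe colouring_adj[OF col] by metis
  qed
  then have "ordered_colouring G k (\<pi> \<circ> f)" using colg by (auto simp: ordered_colouring_def)
  then show ?thesis by blast
qed

end

theorem theorem12:
  fixes G :: "('a, 'b) pre_digraph"
  assumes "graph G" and "co_bipartite G"
  shows "star_chromatic_number G = restricted_star_chromatic_number G \<and>
         restricted_star_chromatic_number G = ordered_chromatic_number G"
proof -
  interpret graph G by fact
  \<comment> \<open>The implications ordered to restricted to star to ordered form a cycle that
    preserves \<open>k\<close>, so the three minima are taken over the same set.\<close>
  have "(\<exists>f. star_colouring G k f) = (\<exists>f. restricted_star_colouring G k f)"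
    and "(\<exists>f. restricted_star_colouring G k f) = (\<exists>f. ordered_colouring G k f)" for k
    using restricted_star_colouring_of_ordered star_colouring_of_restricted
      ordered_colouring_of_star[OF assms(2)] by blast+
  then show ?thesis
    by (simp add: star_chromatic_number_def restricted_star_chromatic_number_def
        ordered_chromatic_number_def)
qed

end
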